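(* Let $(\Phi,\Psi)$ be any pair of jointly Gaussian $\mathcal{D}_0$-GAFs. Then, for $0\le r<1$, \[ \int_{\mathbb{T}}\big|\mathbb{E}\,\Phi(r\zeta)\Psi(r\zeta)\big|^2\,ds(\zeta)\le 2r^2\log\frac{1}{1-r^2}+r^2. \]
   Context: $\mathbb{D}=\{z\in\mathbb{C}:|z|<1\}$, $\mathbb{T}=\partial\mathbb{D}$ is the unit circle, and $ds(\zeta)=\frac{|d\zeta|}{2\pi}$ is normalized arc length measure. A Gaussian Hilbert space $\mathfrak{G}$ is a closed ($\mathbb{C}$-linear) subspace of $L^2(\Omega,dP)$, for a probability space $(\Omega,dP)$, each of whose elements has a complex Gaussian distribution with mean $0$ (real and imaginary parts are jointly Gaussian with mean $0$); $\mathfrak{G}$ is assumed conjugation-invariant ($\gamma\in\mathfrak{G}\iff\bar\gamma\in\mathfrak{G}$). $\mathbb{E}$ denotes expectation, $\mathbb{E}\gamma=\int_\Omega\gamma\,dP$. A standard complex Gaussian variable is a mean-zero complex Gaussian $\gamma$ with $\mathbb{E}(\gamma^2)=0$ and $\mathbb{E}(|\gamma|^2)=1$. A pair of jointly Gaussian $\mathcal{D}_0$-GAFs is a pair $(\Phi,\Psi)$ of random analytic functions on $\mathbb{D}$, \[ \Phi(z)=\sum_{j=1}^{+\infty}\frac{\alpha_j}{\sqrt{j}}\,z^j,\qquad \Psi(z)=\sum_{j=1}^{+\infty}\frac{\beta_j}{\sqrt{j}}\,z^j, \] where $\alpha_1,\alpha_2,\ldots$ are i.i.d. standard complex Gaussian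 variables, $\beta_1,\beta_2,\ldots$ are i.i.d. standard complex Gaussian variables, and all the $\alpha_j$ and $\beta_j$ are taken from one and the same Gaussian Hilbert space $\mathfrak{G}$ (no assumption is made on the correlations between the $\alpha_j$ and the $\beta_k$). *)

theory Defs
  imports "HOL-Probability.Probability"
begin

text \<open>Degenerate (almost surely zero) variables count as Gaussian.\<close>

definition centered_gaussian :: "'a measure \<Rightarrow> ('a \<Rightarrow> real) \<Rightarrow> bool" where
  "centered_gaussian M Y \<longleftrightarrow>
     Y \<in> borel_measurable M \<and>
     ((AE \<omega> in M. Y \<omega> = 0) \<or> (\<exists>\<sigma>>0. distributed M lborel Y (normal_density 0 \<sigma>)))"

text \<open>The real and imaginary parts are jointly Gaussian with mean 0, i.e. every real linear
  combination of them is a centered real Gaussian.\<close>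

definition centered_complex_gaussian :: "'a measure \<Rightarrow> ('a \<Rightarrow> complex) \<Rightarrow> bool" where
  "centered_complex_gaussian M X \<longleftrightarrow>
     (\<forall>a b :: real. centered_gaussian M (\<lambda>\<omega>. a * Re (X \<omega>) + b * Im (X \<omega>)))"

definition standard_complex_gaussian :: "'a measure \<Rightarrow> ('a \<Rightarrow> complex) \<Rightarrow> bool" where
  "standard_complex_gaussian M X \<longleftrightarrow>
     centered_complex_gaussian M X \<and>
     (\<integral>\<omega>. (X \<omega>)\<^sup>2 \<partial>M) = 0 \<and> (\<integral>\<omega>. (cmod (X \<omega>))\<^sup>2 \<partial>M) = 1"

definition L2_functions :: "'a measure \<Rightarrow> ('a \<Rightarrow> complex) set" where
  "L2_functions M = {f \<in> borel_measurable M. integrable M (\<lambda>\<omega>. (cmod (f \<omega>))\<^sup>2)}"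

text \<open>Elements of \<open>L\<^sup>2\<close> are represented by functions rather than by classes of almost
  everywhere equal functions; \<open>closed_L2\<close> forces \<open>G\<close> to be a union of such classes (take a
  constant sequence).\<close>

locale gaussian_hilbert_space = prob_space M for M :: "'a measure" +
  fixes G :: "('a \<Rightarrow> complex) set"
  assumes subset_L2: "G \<subseteq> L2_functions M"
    and zero_mem: "(\<lambda>\<omega>. 0) \<in> G"
    and add_mem: "\<lbrakk>f \<in> G; g \<in> G\<rbrakk> \<Longrightarrow> (\<lambda>\<omega>. f \<omega> + g \<omega>) \<in> G"
    and scale_mem: "f \<in> G \<Longrightarrow> (\<lambda>\<omega>. c * f \<omega>) \<in> G"
    and closed_L2: "\<lbrakk>\<And>n :: nat. u n \<in> G; f \<in> L2_functions M;
           (\<lambda>n. \<integral>\<omega>. (cmod (u n \<omega> - f \<omega>))\<^sup>2 \<partial>M) \<longlonglongrightarrow> 0\<rbrakk> \<Longrightarrow> f \<in> G"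
    and cnj_mem_iff: "f \<in> G \<longleftrightarrow> (\<lambda>\<omega>. cnj (f \<omega>)) \<in> G"
    and gaussian: "f \<in> G \<Longrightarrow> centered_complex_gaussian M f"

text \<open>The coefficients are identically distributed because the standard complex Gaussian law is
  unique. The series converges on the whole open unit disk for almost every \<open>\<omega>\<close>; the value of
  the infinite sum on the exceptional null set plays no role. The sum is indexed from \<open>j = 0\<close>, so
  that \<open>Suc j\<close> is the summation index of the power series.\<close>

definition D0_GAF ::
  "'a measure \<Rightarrow> ('a \<Rightarrow> complex) set \<Rightarrow> ('a \<Rightarrow> complex \<Rightarrow> complex) \<Rightarrow> bool" where
  "D0_GAF M G \<Phi> \<longleftrightarrow>
     (\<exists>\<alpha> :: nat \<Rightarrow> 'a \<Rightarrow> complex.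
        (\<forall>j\<ge>1. \<alpha> j \<in> G \<and> standard_complex_gaussian M (\<alpha> j)) \<and>
        prob_space.indep_vars M (\<lambda>_. borel) \<alpha> {1..} \<and>
        (\<forall>\<omega>\<in>space M. \<forall>z\<in>ball 0 1.
           \<Phi> \<omega> z = (\<Sum>j. \<alpha> (Suc j) \<omega> / of_real (sqrt (real (Suc j))) * z ^ Suc j)))"

text \<open>Joint Gaussianity is the requirement that both sets of coefficients lie in the same
  Gaussian Hilbert space.\<close>

definition jointly_gaussian_D0_GAFs ::
  "'a measure \<Rightarrow> ('a \<Rightarrow> complex) set \<Rightarrow>
    ('a \<Rightarrow> complex \<Rightarrow> complex) \<Rightarrow> ('a \<Rightarrow> complex \<Rightarrow> complex) \<Rightarrow> bool" where
  "jointly_gaussian_D0_GAFs M G \<Phi> \<Psi> \<longleftrightarrow>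
     gaussian_hilbert_space M G \<and> D0_GAF M G \<Phi> \<and> D0_GAF M G \<Psi>"

text \<open>Normalized arc length measure on the unit circle, as a measure on the complex plane.\<close>

definition circle_measure :: "complex measure" where
  "circle_measure = distr (uniform_measure lborel {0..<2 * pi}) borel cis"

end

theory Submission
  imports Defs
begin

text \<open>
  Put \<open>a j k = E(\<alpha>\<^sub>j \<beta>\<^sub>k)\<close>. Both coefficient systems are orthonormal, so by Bessel's inequality all
  rows and columns of \<open>a\<close> have square sum at most 1. The coefficient of \<open>z\<^sup>n\<close> in \<open>E \<Phi>(z)\<Psi>(z)\<close> is the
  sum of \<open>a j k / sqrt (j k)\<close> over the \<open>n - 1\<close> pairs with \<open>j + k = n\<close>, hence by Cauchy-Schwarz its
  square is at most the sum of \<open>n |a j k|\<^sup>2 / (j k) = |a j k|\<^sup>2 (1/j + 1/k)\<close>. Weighting with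
  \<open>s\<^sup>n \<le> s s\<^sup>j\<close> (respectively \<open>s s\<^sup>k\<close>), \<open>s = r\<^sup>2\<close>, and summing over all pairs leaves
  \<open>2 s \<Sum> s\<^sup>j / j = 2 s log (1/(1 - s))\<close>.
\<close>

section \<open>Square-integrable random variables\<close>

lemma borel_measurable_cnj [measurable]: "cnj \<in> borel_measurable borel"
  by (intro borel_measurable_continuous_onI continuous_intros)

lemma integrable_mult_L2:
  assumes "f \<in> L2_functions M" "g \<in> L2_functions M"
  shows "integrable M (\<lambda>\<omega>. f \<omega> * g \<omega>)"
proof (rule Bochner_Integration.integrable_bound)
  show "integrable M (\<lambda>\<omega>. (cmod (f \<omega>))\<^sup>2 + (cmod (g \<omega>))\<^sup>2)"
    using assms by (auto simp: L2_functions_def)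
  show "(\<lambda>\<omega>. f \<omega> * g \<omega>) \<in> borel_measurable M"
    using assms by (auto simp: L2_functions_def)
  have "cmod (f \<omega>) * cmod (g \<omega>) \<le> (cmod (f \<omega>))\<^sup>2 + (cmod (g \<omega>))\<^sup>2" for \<omega>
    using sum_squares_bound[of "cmod (f \<omega>)" "cmod (g \<omega>)"]
      mult_nonneg_nonneg[OF norm_ge_zero norm_ge_zero, of "f \<omega>" "g \<omega>"] by linarith
  then show "AE \<omega> in M. norm (f \<omega> * g \<omega>) \<le> norm ((cmod (f \<omega>))\<^sup>2 + (cmod (g \<omega>))\<^sup>2)"
    by (simp add: norm_mult)
qed

lemma L2_functions_cnj: "f \<in> L2_functions M \<Longrightarrow> (\<lambda>\<omega>. cnj (f \<omega>)) \<in> L2_functions M"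
  by (auto simp: L2_functions_def intro: measurable_compose[OF _ borel_measurable_cnj])

text \<open>By \<open>2 * x * y \<le> x\<^sup>2 + y\<^sup>2\<close>; with both second moments at
  most 1 this does the work of the Cauchy-Schwarz inequality.\<close>

lemma integral_norm_mult_le_1:
  assumes "f \<in> L2_functions M" "g \<in> L2_functions M"
    and "(\<integral>\<omega>. (cmod (f \<omega>))\<^sup>2 \<partial>M) \<le> 1" "(\<integral>\<omega>. (cmod (g \<omega>))\<^sup>2 \<partial>M) \<le> 1"
  shows "(\<integral>\<omega>. cmod (f \<omega> * g \<omega>) \<partial>M) \<le> 1"
proof -
  have "(\<integral>\<omega>. cmod (f \<omega> * g \<omega>) \<partial>M) \<le> (\<integral>\<omega>. ((cmod (f \<omega>))\<^sup>2 + (cmod (g \<omega>))\<^sup>2) / 2 \<partial>M)"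
  proof (rule integral_mono)
    show "integrable M (\<lambda>\<omega>. cmod (f \<omega> * g \<omega>))"
      using integrable_mult_L2[OF assms(1,2)] by (rule integrable_norm)
    show "integrable M (\<lambda>\<omega>. ((cmod (f \<omega>))\<^sup>2 + (cmod (g \<omega>))\<^sup>2) / 2)"
      using assms by (auto simp: L2_functions_def)
    show "cmod (f \<omega> * g \<omega>) \<le> ((cmod (f \<omega>))\<^sup>2 + (cmod (g \<omega>))\<^sup>2) / 2" for \<omega>
      using sum_squares_bound[of "cmod (f \<omega>)" "cmod (g \<omega>)"] by (simp add: norm_mult)
  qed
  also have "\<dots> = ((\<integral>\<omega>. (cmod (f \<omega>))\<^sup>2 \<partial>M) + (\<integral>\<omega>. (cmod (g \<omega>))\<^sup>2 \<partial>M)) / 2"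
    using assms by (subst integral_divide_zero, subst Bochner_Integration.integral_add)
      (auto simp: L2_functions_def)
  also have "\<dots> \<le> (1 + 1) / 2"
    using assms(3,4) by (intro divide_right_mono add_mono) auto
  finally show ?thesis by simp
qed

text \<open>The pairing with \<open>h\<close> is bilinear, to match
  \<open>E(\<alpha> \<beta>)\<close>, so this is Bessel's inequality for the conjugates of the
  \<open>e j\<close>, which are orthonormal along with the \<open>e j\<close>. The squared distance
  from \<open>h\<close> to its projection is nonnegative and expands to the difference of the two
  sides.\<close>

lemma bessel_inequality:
  fixes e :: "'i \<Rightarrow> 'a \<Rightarrow> complex"
  assumes "finite J" and e: "\<And>j. j \<in> J \<Longrightarrow> e j \<in> L2_functions M" and h: "h \<in> L2_functions M"
    and orth: "\<And>i j. \<lbrakk>i \<in> J; j \<in> J\<rbrakk> \<Longrightarrow> (\<integral>\<omega>. e i \<omega> * cnj (e j \<omega>) \<partial>M) = of_bool (i = j)"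
  shows "(\<Sum>j\<in>J. (cmod (\<integral>\<omega>. e j \<omega> * h \<omega> \<partial>M))\<^sup>2) \<le> (\<integral>\<omega>. (cmod (h \<omega>))\<^sup>2 \<partial>M)"
proof -
  define c where "c j = (\<integral>\<omega>. e j \<omega> * h \<omega> \<partial>M)" for j
  define S where "S = (\<Sum>j\<in>J. (cmod (c j))\<^sup>2)"
  have cc: "z * cnj z = of_real ((cmod z)\<^sup>2)" for z
    by (rule complex_norm_square[symmetric])
  note int = integrable_mult_L2 L2_functions_cnj e h
  \<comment> \<open>Expanding \<open>|w|\<^sup>2\<close> as \<open>w * cnj w\<close> gives a finite
    sum of integrable products, so the computation runs over complex integrals and returns to real
    ones at the end.\<close>
  let ?f = "\<lambda>\<omega>. h \<omega> * cnj (h \<omega>) - (\<Sum>j\<in>J. cnj (c j) * (e j \<omega> * h \<omega>))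
      - (\<Sum>j\<in>J. c j * cnj (e j \<omega> * h \<omega>))
      + (\<Sum>i\<in>J. \<Sum>j\<in>J. cnj (c i) * c j * (e i \<omega> * cnj (e j \<omega>)))"
  have eq: "of_real ((cmod (h \<omega> - (\<Sum>j\<in>J. c j * cnj (e j \<omega>))))\<^sup>2) = ?f \<omega>" for \<omega>
    unfolding cc[symmetric]
    by (simp add: algebra_simps sum_distrib_left sum_distrib_right sum_product)
  have "of_real (\<integral>\<omega>. (cmod (h \<omega> - (\<Sum>j\<in>J. c j * cnj (e j \<omega>))))\<^sup>2 \<partial>M) = (\<integral>\<omega>. ?f \<omega> \<partial>M)"
    by (simp only: eq integral_complex_of_real[symmetric])
  also have "\<dots> = (\<integral>\<omega>. h \<omega> * cnj (h \<omega>) \<partial>M) - (\<integral>\<omega>. (\<Sum>j\<in>J. cnj (c j) * (e j \<omega> * h \<omega>)) \<partial>M)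
      - (\<integral>\<omega>. (\<Sum>j\<in>J. c j * cnj (e j \<omega> * h \<omega>)) \<partial>M)
      + (\<integral>\<omega>. (\<Sum>i\<in>J. \<Sum>j\<in>J. cnj (c i) * c j * (e i \<omega> * cnj (e j \<omega>))) \<partial>M)"
  proof -
    have "integrable M (\<lambda>\<omega>. h \<omega> * cnj (h \<omega>))"
      "integrable M (\<lambda>\<omega>. \<Sum>j\<in>J. cnj (c j) * (e j \<omega> * h \<omega>))"
      "integrable M (\<lambda>\<omega>. \<Sum>j\<in>J. c j * cnj (e j \<omega> * h \<omega>))"
      "integrable M (\<lambda>\<omega>. \<Sum>i\<in>J. \<Sum>j\<in>J. cnj (c i) * c j * (e i \<omega> * cnj (e j \<omega>)))"
      by (intro Bochner_Integration.integrable_sum integrable_mult_right integrable_cnj int;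
          assumption)+
    then show ?thesis
      by (simp only: Bochner_Integration.integral_add Bochner_Integration.integral_diff
            Bochner_Integration.integrable_diff)
  qed
  also have "(\<integral>\<omega>. h \<omega> * cnj (h \<omega>) \<partial>M) = of_real (\<integral>\<omega>. (cmod (h \<omega>))\<^sup>2 \<partial>M)"
    by (simp only: cc integral_complex_of_real)
  also have "(\<integral>\<omega>. (\<Sum>j\<in>J. cnj (c j) * (e j \<omega> * h \<omega>)) \<partial>M) = (\<Sum>j\<in>J. cnj (c j) * c j)"
    by (subst Bochner_Integration.integral_sum)
       (auto intro!: integrable_mult_right int simp: c_def)
  also have "(\<integral>\<omega>. (\<Sum>j\<in>J. c j * cnj (e j \<omega> * h \<omega>)) \<partial>M) = (\<Sum>j\<in>J. c j * cnj (c j))"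
    by (subst Bochner_Integration.integral_sum)
       (auto intro!: integrable_mult_right integrable_cnj int simp: c_def
         simp del: complex_cnj_mult)
  also have "(\<integral>\<omega>. (\<Sum>i\<in>J. \<Sum>j\<in>J. cnj (c i) * c j * (e i \<omega> * cnj (e j \<omega>))) \<partial>M)
     = (\<Sum>i\<in>J. \<Sum>j\<in>J. cnj (c i) * c j * of_bool (i = j))"
    by (subst Bochner_Integration.integral_sum,
        (intro Bochner_Integration.integrable_sum integrable_mult_right int; assumption),
        intro sum.cong refl, subst Bochner_Integration.integral_sum,
        (intro integrable_mult_right int; assumption),
        intro sum.cong refl, simp add: orth)
  also have "\<dots> = (\<Sum>j\<in>J. c j * cnj (c j))"
    using \<open>finite J\<close> by (intro sum.cong) (auto simp: mult.commute)
  also have "(\<Sum>j\<in>J. cnj (c j) * c j) = (\<Sum>j\<in>J. c j * cnj (c j))"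
    by (simp add: mult.commute)
  also have "(\<Sum>j\<in>J. c j * cnj (c j)) = of_real S"
    by (simp only: cc S_def of_real_sum)
  \<comment> \<open>Both cross terms and the double sum equal \<open>S\<close>; their signs are
    minus, minus, plus, so a single \<open>- S\<close> survives.\<close>
  finally have "complex_of_real (\<integral>\<omega>. (cmod (h \<omega> - (\<Sum>j\<in>J. c j * cnj (e j \<omega>))))\<^sup>2 \<partial>M)
      = of_real ((\<integral>\<omega>. (cmod (h \<omega>))\<^sup>2 \<partial>M) - S)"
    by simp
  then have "(\<integral>\<omega>. (cmod (h \<omega> - (\<Sum>j\<in>J. c j * cnj (e j \<omega>))))\<^sup>2 \<partial>M)
      = (\<integral>\<omega>. (cmod (h \<omega>))\<^sup>2 \<partial>M) - S"
    by (simp only: of_real_eq_iff)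
  moreover have "0 \<le> (\<integral>\<omega>. (cmod (h \<omega> - (\<Sum>j\<in>J. c j * cnj (e j \<omega>))))\<^sup>2 \<partial>M)"
    by simp
  ultimately show ?thesis unfolding S_def c_def by simp
qed

section \<open>Gaussian variables\<close>

lemma (in prob_space) centered_gaussian_expectation:
  assumes "centered_gaussian M Y"
  shows "expectation Y = 0"
proof -
  have [measurable]: "Y \<in> borel_measurable M"
    using assms by (simp add: centered_gaussian_def)
  show ?thesis
    using assms integral_cong_AE[of Y M "\<lambda>_. 0"]
    by (auto simp: centered_gaussian_def intro: normal_distributed_expectation)
qed

lemma (in prob_space) centered_complex_gaussian_expectation:
  assumes "centered_complex_gaussian M X" "integrable M X"
  shows "expectation X = 0"
proof (rule complex_eqI)
  have X: "centered_gaussian M (\<lambda>\<omega>. a * Re (X \<omega>) + b * Im (X \<omega>))" for a b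
    using assms(1) by (simp add: centered_complex_gaussian_def)
  show "Re (expectation X) = Re 0" "Im (expectation X) = Im 0"
    using centered_gaussian_expectation[OF X[of 1 0]] centered_gaussian_expectation[OF X[of 0 1]]
      assms(2) by simp_all
qed

text \<open>Off the diagonal, independence factors the expectation and the mean of
  \<open>\<alpha> i\<close> is 0; on the diagonal the value is the normalization
  \<open>E |\<alpha> i|\<^sup>2 = 1\<close>.\<close>

lemma (in gaussian_hilbert_space) indep_standard_gaussians_orthonormal:
  assumes \<alpha>: "\<And>j. j \<in> I \<Longrightarrow> \<alpha> j \<in> G \<and> standard_complex_gaussian M (\<alpha> j)"
    and ind: "indep_vars (\<lambda>_. borel) \<alpha> I" and ij: "i \<in> I" "j \<in> I"
  shows "(\<integral>\<omega>. \<alpha> i \<omega> * cnj (\<alpha> j \<omega>) \<partial>M) = of_bool (i = j)"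
proof (cases "i = j")
  case True
  have "(\<integral>\<omega>. \<alpha> i \<omega> * cnj (\<alpha> i \<omega>) \<partial>M) = of_real (\<integral>\<omega>. (cmod (\<alpha> i \<omega>))\<^sup>2 \<partial>M)"
    by (simp only: complex_norm_square[symmetric] integral_complex_of_real)
  then show ?thesis using \<alpha>[OF ij(1)] True by (simp add: standard_complex_gaussian_def)
next
  case False
  \<comment> \<open>Conjugating only the member at \<open>j\<close> turns the plain product over
    \<open>{i, j}\<close> into the Hermitian pairing; independence survives composition with
    measurable maps.\<close>
  define Y where "Y = (\<lambda>k \<omega>. if k = j then cnj (\<alpha> k \<omega>) else \<alpha> k \<omega>)"
  have int: "integrable M (\<alpha> k)" if "k \<in> I" for k
  proof -
    have "\<alpha> k \<in> L2_functions M" using \<alpha>[OF that] subset_L2 by auto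
    \<comment> \<open>On a probability space, pairing with the constant 1 shows that
      square-integrable variables are integrable.\<close>
    moreover have "(\<lambda>_. 1) \<in> L2_functions M" by (simp add: L2_functions_def)
    ultimately show ?thesis using integrable_mult_L2 by fastforce
  qed
  have "indep_vars (\<lambda>_. borel) \<alpha> {i, j}"
    using ind by (rule indep_vars_subset) (use ij in auto)
  then have "indep_vars (\<lambda>_. borel) (\<lambda>k \<omega>. (if k = j then cnj else id) (\<alpha> k \<omega>)) {i, j}"
    by (rule indep_vars_compose2) auto
  then have Y: "indep_vars (\<lambda>_. borel) Y {i, j}"
    by (rule indep_vars_cong[THEN iffD1, rotated -1]) (auto simp: Y_def)
  have Y_int: "integrable M (Y k)" if "k \<in> {i, j}" for k
    using that ij int by (cases "k = j") (auto simp: Y_def intro: integrable_cnj)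
  have "(\<integral>\<omega>. (\<Prod>k\<in>{i, j}. Y k \<omega>) \<partial>M) = (\<Prod>k\<in>{i, j}. \<integral>\<omega>. Y k \<omega> \<partial>M)"
    by (rule indep_vars_lebesgue_integral) (use Y Y_int in auto)
  moreover have "(\<integral>\<omega>. \<alpha> i \<omega> \<partial>M) = 0"
    using \<alpha>[OF ij(1)] int[OF ij(1)] gaussian by (auto intro: centered_complex_gaussian_expectation)
  ultimately show ?thesis using False by (simp add: Y_def)
qed

section \<open>Expectation of a product of random series\<close>

text \<open>Pairing with the constant 1 gives \<open>E |\<alpha> i| \<le> 1\<close>, so the series
  of absolute values has expectation at most the finite sum of the \<open>|u i|\<close>, and is
  therefore finite almost surely.\<close>

lemma (in prob_space) AE_summable_L2_bounded:
  assumes "\<And>i. \<alpha> i \<in> L2_functions M" "\<And>i. (\<integral>\<omega>. (cmod (\<alpha> i \<omega>))\<^sup>2 \<partial>M) \<le> 1"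
    and u: "summable (\<lambda>i. cmod (u i))"
  shows "AE \<omega> in M. summable (\<lambda>i. norm (\<alpha> i \<omega> * u i))"
proof -
  have [measurable]: "\<alpha> i \<in> borel_measurable M" for i
    using assms(1) by (simp add: L2_functions_def)
  have one: "(\<lambda>_. 1) \<in> L2_functions M" by (simp add: L2_functions_def)
  have le: "(\<integral>\<omega>. cmod (\<alpha> i \<omega>) \<partial>M) \<le> 1" and int: "integrable M (\<alpha> i)" for i
    using integral_norm_mult_le_1[OF assms(1) one assms(2)] integrable_mult_L2[OF assms(1) one]
    by (simp_all add: prob_space)
  have "(\<integral>\<^sup>+\<omega>. (\<Sum>i. ennreal (norm (\<alpha> i \<omega> * u i))) \<partial>M)
      = (\<Sum>i. \<integral>\<^sup>+\<omega>. ennreal (norm (\<alpha> i \<omega> * u i)) \<partial>M)"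
    by (rule nn_integral_suminf) auto
  also have "\<dots> = (\<Sum>i. ennreal (\<integral>\<omega>. norm (\<alpha> i \<omega> * u i) \<partial>M))"
    using int by (intro suminf_cong nn_integral_eq_integral integrable_norm) auto
  also have "\<dots> \<le> (\<Sum>i. ennreal (cmod (u i)))"
    using mult_right_mono[OF le norm_ge_zero] by (intro suminf_le ennreal_leI) (auto simp: norm_mult)
  also have "\<dots> < \<infinity>"
    using u by (simp add: ennreal_suminf_neq_top less_top[symmetric])
  finally have "AE \<omega> in M. (\<Sum>i. ennreal (norm (\<alpha> i \<omega> * u i))) \<noteq> \<infinity>"
    by (intro nn_integral_PInf_AE) auto
  then show ?thesis
    by eventually_elim (rule summable_suminf_not_top, auto)
qed

text \<open>Almost surely both series converge absolutely, so their product is the Cauchy product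
  with terms \<open>T m\<close>. Since \<open>E |\<alpha> i * \<beta> k| \<le> 1\<close>, the means
  of \<open>|T m|\<close> are dominated by the Cauchy product of the series of \<open>|u i|\<close>
  with itself, which permits integration term by term.\<close>

lemma (in prob_space) expectation_product_series:
  assumes \<alpha>: "\<And>i. \<alpha> i \<in> L2_functions M" "\<And>i. (\<integral>\<omega>. (cmod (\<alpha> i \<omega>))\<^sup>2 \<partial>M) \<le> 1"
    and \<beta>: "\<And>i. \<beta> i \<in> L2_functions M" "\<And>i. (\<integral>\<omega>. (cmod (\<beta> i \<omega>))\<^sup>2 \<partial>M) \<le> 1"
    and u: "summable (\<lambda>i. cmod (u i))"
  shows "(\<lambda>m. \<Sum>i\<le>m. (\<integral>\<omega>. \<alpha> i \<omega> * \<beta> (m - i) \<omega> \<partial>M) * (u i * u (m - i)))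
     sums (\<integral>\<omega>. (\<Sum>i. \<alpha> i \<omega> * u i) * (\<Sum>i. \<beta> i \<omega> * u i) \<partial>M)"
proof -
  have [measurable]: "\<alpha> i \<in> borel_measurable M" "\<beta> i \<in> borel_measurable M" for i
    using \<alpha>(1) \<beta>(1) by (auto simp: L2_functions_def)
  define T where "T m \<omega> = (\<Sum>i\<le>m. (\<alpha> i \<omega> * u i) * (\<beta> (m - i) \<omega> * u (m - i)))" for m \<omega>
  have T_eq: "T m \<omega> = (\<Sum>i\<le>m. (\<alpha> i \<omega> * \<beta> (m - i) \<omega>) * (u i * u (m - i)))" for m \<omega>
    by (simp add: T_def mult_ac)
  have T_meas [measurable]: "T m \<in> borel_measurable M" for m
    unfolding T_def by measurable
  note int = integrable_mult_L2[OF \<alpha>(1) \<beta>(1)]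
  have AE: "AE \<omega> in M. summable (\<lambda>i. norm (\<alpha> i \<omega> * u i)) \<and> summable (\<lambda>i. norm (\<beta> i \<omega> * u i))"
    using AE_summable_L2_bounded[OF \<alpha> u] AE_summable_L2_bounded[OF \<beta> u] by eventually_elim auto
  have T_int: "integrable M (T m)" for m
    unfolding T_eq using int by (intro Bochner_Integration.integrable_sum integrable_mult_left) auto
  have "(\<lambda>m. integral\<^sup>L M (T m)) sums (\<integral>\<omega>. (\<Sum>m. T m \<omega>) \<partial>M)"
  proof (rule sums_integral[OF T_int])
    show "AE \<omega> in M. summable (\<lambda>m. norm (T m \<omega>))"
      using AE
    proof eventually_elim
      case (elim \<omega>)
      have "summable (\<lambda>m. \<Sum>i\<le>m. norm (\<alpha> i \<omega> * u i) * norm (\<beta> (m - i) \<omega> * u (m - i)))"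
        using elim by (intro sums_summable[OF Cauchy_product_sums]) auto
      then show ?case
        by (rule summable_comparison_test')
           (auto simp: T_def norm_mult[symmetric] intro: norm_sum)
    qed
    have "summable (\<lambda>m. \<Sum>i\<le>m. cmod (u i) * cmod (u (m - i)))"
      using u by (intro sums_summable[OF Cauchy_product_sums]) auto
    then show "summable (\<lambda>m. \<integral>\<omega>. norm (T m \<omega>) \<partial>M)"
    proof (rule summable_comparison_test')
      fix m :: nat
      let ?F = "\<lambda>i \<omega>. cmod (\<alpha> i \<omega> * \<beta> (m - i) \<omega>) * (cmod (u i) * cmod (u (m - i)))"
      have F_int: "integrable M (?F i)" for i
        using int by (intro integrable_mult_left integrable_norm) auto
      have "(\<integral>\<omega>. norm (T m \<omega>) \<partial>M) \<le> (\<integral>\<omega>. (\<Sum>i\<le>m. ?F i \<omega>) \<partial>M)"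
        unfolding T_eq
        by (intro integral_mono Bochner_Integration.integrable_sum F_int integrable_norm
             T_int[unfolded T_eq] sum_norm_le) (simp add: norm_mult)
      also have "\<dots> = (\<Sum>i\<le>m. \<integral>\<omega>. ?F i \<omega> \<partial>M)"
        using F_int by (intro Bochner_Integration.integral_sum)
      also have "\<dots> \<le> (\<Sum>i\<le>m. 1 * (cmod (u i) * cmod (u (m - i))))"
        unfolding integral_mult_left_zero
        by (intro sum_mono mult_right_mono integral_norm_mult_le_1 \<alpha> \<beta>) auto
      finally show "norm (\<integral>\<omega>. norm (T m \<omega>) \<partial>M) \<le> (\<Sum>i\<le>m. cmod (u i) * cmod (u (m - i)))"
        by simp
    qed
  qed
  \<comment> \<open>Where absolute convergence fails the product formula may fail too, so the
    integrands are compared only almost everywhere.\<close>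
  also have "(\<integral>\<omega>. (\<Sum>m. T m \<omega>) \<partial>M) = (\<integral>\<omega>. (\<Sum>i. \<alpha> i \<omega> * u i) * (\<Sum>i. \<beta> i \<omega> * u i) \<partial>M)"
  proof (rule integral_cong_AE)
    show "AE \<omega> in M. (\<Sum>m. T m \<omega>) = (\<Sum>i. \<alpha> i \<omega> * u i) * (\<Sum>i. \<beta> i \<omega> * u i)"
      using AE unfolding T_def by eventually_elim (auto intro: Cauchy_product[symmetric])
  qed measurable
  also have "(\<lambda>m. integral\<^sup>L M (T m))
      = (\<lambda>m. \<Sum>i\<le>m. (\<integral>\<omega>. \<alpha> i \<omega> * \<beta> (m - i) \<omega> \<partial>M) * (u i * u (m - i)))"
    unfolding T_eq using int by (subst Bochner_Integration.integral_sum) auto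
  finally show ?thesis .
qed

section \<open>Power series on the circle\<close>

lemma borel_measurable_cis [measurable]: "cis \<in> borel_measurable borel"
  by (intro borel_measurable_continuous_onI continuous_intros)

text \<open>Including the null endpoint \<open>2 * pi\<close> gives the compact interval on which
  the fundamental theorem of calculus will be applied.\<close>

lemma integral_circle_measure:
  fixes f :: "complex \<Rightarrow> 'b::{banach, second_countable_topology}"
  assumes [measurable]: "f \<in> borel_measurable borel"
  shows "(\<integral>\<zeta>. f \<zeta> \<partial>circle_measure)
    = (1 / (2 * pi)) *\<^sub>R (\<integral>t. indicator {0..2 * pi} t *\<^sub>R f (cis t) \<partial>lborel)"
proof -
  have d: "uniform_measure lborel {0..<2 * pi}
      = density lborel (\<lambda>t. ennreal (indicator {0..<2 * pi} t / (2 * pi)))"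
    unfolding uniform_measure_def
    by (intro density_cong) (auto simp: divide_ennreal[symmetric] split: split_indicator)
  have "(\<integral>\<zeta>. f \<zeta> \<partial>circle_measure) = (\<integral>t. f (cis t) \<partial>uniform_measure lborel {0..<2 * pi})"
    unfolding circle_measure_def by (intro integral_distr) auto
  also have "\<dots> = (\<integral>t. (indicator {0..<2 * pi} t / (2 * pi)) *\<^sub>R f (cis t) \<partial>lborel)"
    unfolding d by (intro integral_density) auto
  also have "\<dots> = (\<integral>t. (1 / (2 * pi)) *\<^sub>R (indicator {0..2 * pi} t *\<^sub>R f (cis t)) \<partial>lborel)"
  proof (rule integral_cong_AE)
    show "AE t in lborel. (indicator {0..<2 * pi} t / (2 * pi)) *\<^sub>R f (cis t)
        = (1 / (2 * pi)) *\<^sub>R (indicator {0..2 * pi} t *\<^sub>R f (cis t))"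
      using AE_lborel_singleton[of "2 * pi"] by eventually_elim (auto split: split_indicator)
  qed auto
  finally show ?thesis by (simp only: integral_scaleR_right)
qed

lemma prob_space_circle_measure: "prob_space circle_measure"
proof -
  have "prob_space (uniform_measure lborel {0..<2 * pi})"
    by (intro prob_space_uniform_measure) auto
  then show ?thesis
    unfolding circle_measure_def by (intro prob_space.prob_space_distr) auto
qed

lemma sets_circle_measure [measurable_cong]: "sets circle_measure = sets borel"
  by (simp add: circle_measure_def)

lemma AE_circle_measure: "AE \<zeta> in circle_measure. cmod \<zeta> = 1"
proof -
  show ?thesis unfolding circle_measure_def by (subst AE_distr_iff) auto
qed

text \<open>For equal exponents the integrand is 1 on the circle. Otherwise it is
  \<open>cis (k * t)\<close> with a nonzero integer \<open>k\<close>, and its antiderivative takes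
  equal values at 0 and \<open>2 * pi\<close>.\<close>

lemma integral_circle_monomial:
  "(\<integral>\<zeta>. \<zeta> ^ m * cnj (\<zeta> ^ n) \<partial>circle_measure) = of_bool (m = n)"
proof (cases "m = n")
  case True
  have "(\<integral>\<zeta>. \<zeta> ^ m * cnj (\<zeta> ^ n) \<partial>circle_measure) = (\<integral>\<zeta>. 1 \<partial>circle_measure)"
  proof (rule integral_cong_AE)
    show "AE \<zeta> in circle_measure. \<zeta> ^ m * cnj (\<zeta> ^ n) = 1"
      using AE_circle_measure
      by eventually_elim (simp only: True complex_norm_square[symmetric], simp add: norm_power)
  qed measurable
  then show ?thesis using True prob_space.prob_space[OF prob_space_circle_measure] by simp
next
  case False
  define k where "k = real m - real n"
  have k: "k \<noteq> 0" using False by (simp add: k_def)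
  have "(\<integral>\<zeta>. \<zeta> ^ m * cnj (\<zeta> ^ n) \<partial>circle_measure)
      = (1 / (2 * pi)) *\<^sub>R (\<integral>t. indicator {0..2 * pi} t *\<^sub>R (cis t ^ m * cnj (cis t ^ n)) \<partial>lborel)"
    by (rule integral_circle_measure) auto
  also have "(\<lambda>t. cis t ^ m * cnj (cis t ^ n)) = (\<lambda>t. cis (k * t))"
  proof
    fix t
    have "cis t ^ m * cnj (cis t ^ n) = cis (real m * t) * cis (- (real n * t))"
      by (simp only: Complex.DeMoivre cis_cnj)
    also have "\<dots> = cis (k * t)"
      by (simp add: cis_mult k_def algebra_simps)
    finally show "cis t ^ m * cnj (cis t ^ n) = cis (k * t)" .
  qed
  also have "(\<integral>t. indicator {0..2 * pi} t *\<^sub>R cis (k * t) \<partial>lborel)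
      = cis (k * (2 * pi)) / (\<i> * k) - cis (k * 0) / (\<i> * k)"
  proof (rule integral_FTC_Icc)
    show "((\<lambda>t. cis (k * t) / (\<i> * k)) has_vector_derivative cis (k * t)) (at t within {0..2 * pi})" for t
    proof -
      \<comment> \<open>The antiderivative is differentiated in a complex variable and then
        restricted to the real axis.\<close>
      have "((\<lambda>z. exp (\<i> * k * z) / (\<i> * k)) has_field_derivative exp (\<i> * k * of_real t)) (at (of_real t))"
        using k by (auto intro!: derivative_eq_intros)
      from has_vector_derivative_real_field[OF this] show ?thesis
        by (simp add: cis_conv_exp mult_ac)
    qed
    show "continuous_on {0..2 * pi} (\<lambda>t. cis (k * t))"
      by (intro continuous_intros)
  qed simp
  also have "cis (k * (2 * pi)) = 1"
  proof -
    have "k * (2 * pi) = 2 * pi * of_int (int m - int n)" by (simp add: k_def)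
    then show ?thesis by (simp only: cis_multiple_2pi Ints_of_int)
  qed
  finally show ?thesis using False by simp
qed

text \<open>The shift \<open>k\<close> serves series that start at a higher power; shifted monomials
  are still orthonormal, so only the diagonal of the expanded square remains.\<close>

lemma parseval_polynomial:
  "(\<integral>\<zeta>. (cmod (\<Sum>m<N. c m * \<zeta> ^ (m + k)))\<^sup>2 \<partial>circle_measure) = (\<Sum>m<N. (cmod (c m))\<^sup>2)"
proof -
  have int: "integrable circle_measure (\<lambda>\<zeta>. \<zeta> ^ m * cnj (\<zeta> ^ n))" for m n
  proof (rule finite_measure.integrable_const_bound)
    show "finite_measure circle_measure"
      using prob_space_circle_measure by (simp add: prob_space_def)
    show "AE \<zeta> in circle_measure. norm (\<zeta> ^ m * cnj (\<zeta> ^ n)) \<le> 1"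
      using AE_circle_measure by eventually_elim (simp add: norm_mult norm_power)
  qed measurable
  have eq: "of_real ((cmod (\<Sum>m<N. c m * \<zeta> ^ (m + k)))\<^sup>2)
      = (\<Sum>m<N. \<Sum>n<N. (c m * cnj (c n)) * (\<zeta> ^ (m + k) * cnj (\<zeta> ^ (n + k))))" for \<zeta>
    by (simp only: complex_norm_square cnj_sum complex_cnj_mult sum_product mult_ac)
  have "of_real (\<integral>\<zeta>. (cmod (\<Sum>m<N. c m * \<zeta> ^ (m + k)))\<^sup>2 \<partial>circle_measure)
      = (\<integral>\<zeta>. (\<Sum>m<N. \<Sum>n<N. (c m * cnj (c n)) * (\<zeta> ^ (m + k) * cnj (\<zeta> ^ (n + k)))) \<partial>circle_measure)"
    by (simp only: eq integral_complex_of_real[symmetric])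
  also have "\<dots> = (\<Sum>m<N. \<Sum>n<N. (c m * cnj (c n)) * of_bool (m = n))"
    using int
    by (simp add: integral_circle_monomial Bochner_Integration.integral_sum
          del: complex_cnj_power)
  also have "\<dots> = (\<Sum>m<N. c m * cnj (c m))"
    by (intro sum.cong refl) auto
  also have "\<dots> = of_real (\<Sum>m<N. (cmod (c m))\<^sup>2)"
    by (simp only: complex_norm_square of_real_sum)
  finally show ?thesis by (simp only: of_real_eq_iff)
qed

text \<open>Parseval for the partial sums, then dominated convergence with the constant majorant
  \<open>(\<Sum>m. cmod (c m))\<^sup>2\<close>.\<close>

lemma parseval_le:
  assumes sums: "\<And>\<zeta>. cmod \<zeta> = 1 \<Longrightarrow> (\<lambda>m. c m * \<zeta> ^ (m + k)) sums f \<zeta>"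
    and c: "summable (\<lambda>m. cmod (c m))"
    and le: "\<And>N. (\<Sum>m<N. (cmod (c m))\<^sup>2) \<le> B"
  shows "(\<integral>\<zeta>. (cmod (f \<zeta>))\<^sup>2 \<partial>circle_measure) \<le> B"
proof -
  interpret prob_space circle_measure by (rule prob_space_circle_measure)
  \<comment> \<open>\<open>f\<close> is determined only on the circle and need not be Borel
    measurable; \<open>g\<close> is a Borel function that agrees with it there.\<close>
  define g where "g \<zeta> = (\<Sum>m. c m * \<zeta> ^ (m + k))" for \<zeta>
  have [measurable]: "g \<in> borel_measurable borel" unfolding g_def by measurable
  have fg: "f \<zeta> = g \<zeta>" if "cmod \<zeta> = 1" for \<zeta>
    using sums[OF that] by (simp add: g_def sums_iff)
  have "(\<lambda>N. \<integral>\<zeta>. (cmod (\<Sum>m<N. c m * \<zeta> ^ (m + k)))\<^sup>2 \<partial>circle_measure)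
      \<longlonglongrightarrow> (\<integral>\<zeta>. (cmod (g \<zeta>))\<^sup>2 \<partial>circle_measure)"
  proof (rule integral_dominated_convergence)
    show "integrable circle_measure (\<lambda>_. (\<Sum>m. cmod (c m))\<^sup>2)" by simp
    show "AE \<zeta> in circle_measure.
        (\<lambda>N. (cmod (\<Sum>m<N. c m * \<zeta> ^ (m + k)))\<^sup>2) \<longlonglongrightarrow> (cmod (g \<zeta>))\<^sup>2"
      using AE_circle_measure
    proof eventually_elim
      case (elim \<zeta>)
      then show ?case
        using sums[OF elim] fg[OF elim] by (intro tendsto_intros) (simp add: sums_def)
    qed
    show "AE \<zeta> in circle_measure. norm ((cmod (\<Sum>m<N. c m * \<zeta> ^ (m + k)))\<^sup>2) \<le> (\<Sum>m. cmod (c m))\<^sup>2" for N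
      using AE_circle_measure
    proof eventually_elim
      case (elim \<zeta>)
      have "cmod (\<Sum>m<N. c m * \<zeta> ^ (m + k)) \<le> (\<Sum>m<N. cmod (c m))"
        by (rule sum_norm_le) (simp add: norm_mult norm_power elim)
      also have "\<dots> \<le> (\<Sum>m. cmod (c m))"
        using c by (rule sum_le_suminf) auto
      finally show ?case by (simp add: power_mono)
    qed
  qed auto
  then have "(\<integral>\<zeta>. (cmod (g \<zeta>))\<^sup>2 \<partial>circle_measure) \<le> B"
    by (rule LIMSEQ_le_const2) (use le in \<open>auto simp: parseval_polynomial\<close>)
  moreover have "0 \<le> B" using le[of 0] by simp
  \<comment> \<open>Integrability supplies the measurability for this comparison. In the other case
    the Bochner integral is 0 by convention and the claim becomes \<open>0 \<le> B\<close>.\<close>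
  moreover have "(\<integral>\<zeta>. (cmod (f \<zeta>))\<^sup>2 \<partial>circle_measure) = (\<integral>\<zeta>. (cmod (g \<zeta>))\<^sup>2 \<partial>circle_measure)"
    if "integrable circle_measure (\<lambda>\<zeta>. (cmod (f \<zeta>))\<^sup>2)"
  proof (rule integral_cong_AE)
    show "AE \<zeta> in circle_measure. (cmod (f \<zeta>))\<^sup>2 = (cmod (g \<zeta>))\<^sup>2"
      using AE_circle_measure by eventually_elim (simp add: fg)
  qed (use that in auto)
  ultimately show ?thesis
    by (cases "integrable circle_measure (\<lambda>\<zeta>. (cmod (f \<zeta>))\<^sup>2)")
       (auto simp: not_integrable_integral_eq)
qed

section \<open>The coefficient estimate\<close>

text \<open>Partial sums of the logarithmic series for \<open>- ln (1 - s)\<close>, whose terms are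
  nonnegative.\<close>

lemma sum_power_div_le_ln:
  assumes "0 \<le> s" "s < (1::real)"
  shows "(\<Sum>i<N. s ^ Suc i / real (Suc i)) \<le> ln (1 / (1 - s))"
proof -
  have "(\<lambda>n. - (s ^ n / real n)) sums ln (1 - s)"
    using ln_series'[of "- s"] assms by simp
  then have "(\<lambda>n. s ^ n / real n) sums ln (1 / (1 - s))"
    using sums_minus[of "\<lambda>n. - (s ^ n / real n)"] assms by (simp add: ln_div)
  \<comment> \<open>The term at \<open>n = 0\<close> is \<open>1 / 0 = 0\<close> by convention, so
    dropping it does not change the sum.\<close>
  then have "(\<lambda>n. s ^ Suc n / real (Suc n)) sums ln (1 / (1 - s))"
    by (subst sums_Suc_iff) simp
  then show ?thesis
    using sum_le_suminf[of "\<lambda>n. s ^ Suc n / real (Suc n)" "{..<N}"] assms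
    by (simp add: sums_iff del: power_Suc of_nat_Suc)
qed

text \<open>Put \<open>j = Suc i\<close> and \<open>k = Suc (m - i)\<close>. Cauchy-Schwarz against
  the constant 1 costs the number of terms, \<open>m + 1\<close>, which is below
  \<open>j + k = m + 2\<close>; then \<open>(j + k) / (j * k)\<close> splits into
  \<open>1 / j + 1 / k\<close>.\<close>

lemma weighted_diagonal_bound:
  fixes a :: "nat \<Rightarrow> nat \<Rightarrow> complex"
  shows "(cmod (\<Sum>i\<le>m. a i (m - i) / of_real (sqrt (real (Suc i)) * sqrt (real (Suc (m - i))))))\<^sup>2
    \<le> (\<Sum>i\<le>m. (cmod (a i (m - i)))\<^sup>2 * (1 / real (Suc i) + 1 / real (Suc (m - i))))"
proof -
  let ?b = "\<lambda>i. cmod (a i (m - i)) / (sqrt (real (Suc i)) * sqrt (real (Suc (m - i))))"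
  have "cmod (\<Sum>i\<le>m. a i (m - i) / of_real (sqrt (real (Suc i)) * sqrt (real (Suc (m - i)))))
      \<le> (\<Sum>i\<le>m. ?b i)"
    by (rule sum_norm_le) (simp add: norm_divide norm_mult)
  then have "(cmod (\<Sum>i\<le>m. a i (m - i) / of_real (sqrt (real (Suc i)) * sqrt (real (Suc (m - i))))))\<^sup>2
      \<le> (\<Sum>i\<le>m. ?b i * 1)\<^sup>2"
    by (simp add: power_mono)
  also have "\<dots> \<le> (\<Sum>i\<le>m. (?b i)\<^sup>2) * (\<Sum>i\<le>m. 1\<^sup>2)"
    by (rule Cauchy_Schwarz_ineq_sum)
  also have "\<dots> = (\<Sum>i\<le>m. (?b i)\<^sup>2 * real (Suc m))"
    by (simp add: sum_distrib_right)
  also have "\<dots> \<le> (\<Sum>i\<le>m. (cmod (a i (m - i)))\<^sup>2 * (1 / real (Suc i) + 1 / real (Suc (m - i))))"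
  proof (rule sum_mono)
    fix i assume "i \<in> {..m}"
    then have "real (Suc m) \<le> real (Suc i) + real (Suc (m - i))" by simp
    then have "(cmod (a i (m - i)))\<^sup>2 * (real (Suc m) / (real (Suc i) * real (Suc (m - i))))
      \<le> (cmod (a i (m - i)))\<^sup>2 * ((real (Suc i) + real (Suc (m - i))) / (real (Suc i) * real (Suc (m - i))))"
      by (intro mult_left_mono divide_right_mono) auto
    also have "(real (Suc i) + real (Suc (m - i))) / (real (Suc i) * real (Suc (m - i)))
        = 1 / real (Suc i) + 1 / real (Suc (m - i))"
      by (simp add: add_divide_distrib del: of_nat_Suc)
    finally show "(?b i)\<^sup>2 * real (Suc m)
        \<le> (cmod (a i (m - i)))\<^sup>2 * (1 / real (Suc i) + 1 / real (Suc (m - i)))"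
      by (simp add: power_divide power_mult_distrib del: of_nat_Suc)
  qed
  finally show ?thesis .
qed

text \<open>Splitting the weight decouples the indices: one part is summed along rows, the other
  along columns. Each row or column has mass at most 1, so each part leaves one logarithmic
  series.\<close>

lemma diagonal_sum_bound:
  fixes a :: "nat \<Rightarrow> nat \<Rightarrow> complex" and s :: real
  assumes s: "0 \<le> s" "s < 1"
    and rows: "\<And>i N. (\<Sum>k<N. (cmod (a i k))\<^sup>2) \<le> 1"
    and cols: "\<And>k N. (\<Sum>i<N. (cmod (a i k))\<^sup>2) \<le> 1"
  shows "(\<Sum>m<N. s ^ (m + 2)
        * (cmod (\<Sum>i\<le>m. a i (m - i) / of_real (sqrt (real (Suc i)) * sqrt (real (Suc (m - i))))))\<^sup>2)
    \<le> 2 * s * ln (1 / (1 - s))"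
proof -
  \<comment> \<open>Majorant of the weighted term at \<open>(i, k)\<close>. The factor
    \<open>s\<close> comes out because the exponent \<open>Suc i + Suc k\<close> exceeds each of
    \<open>Suc i\<close> and \<open>Suc k\<close> by at least 1.\<close>
  define g where "g i k = (cmod (a i k))\<^sup>2 * s * (s ^ Suc i / real (Suc i) + s ^ Suc k / real (Suc k))"
    for i k
  \<comment> \<open>Stated for a general \<open>b\<close> because it is used twice: for the squared
    moduli and for their transpose.\<close>
  have half: "(\<Sum>i<N. s ^ Suc i / real (Suc i) * (\<Sum>k<N. b i k)) \<le> ln (1 / (1 - s))"
    if b: "\<And>i. (\<Sum>k<N. b i k) \<le> 1" for b :: "nat \<Rightarrow> nat \<Rightarrow> real"
  proof -
    have "(\<Sum>i<N. s ^ Suc i / real (Suc i) * (\<Sum>k<N. b i k)) \<le> (\<Sum>i<N. s ^ Suc i / real (Suc i) * 1)"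
      using s b by (intro sum_mono mult_left_mono) auto
    also have "\<dots> \<le> ln (1 / (1 - s))"
      using sum_power_div_le_ln[OF s] by simp
    finally show ?thesis .
  qed
  have "(\<Sum>m<N. s ^ (m + 2)
        * (cmod (\<Sum>i\<le>m. a i (m - i) / of_real (sqrt (real (Suc i)) * sqrt (real (Suc (m - i))))))\<^sup>2)
      \<le> (\<Sum>m<N. s ^ (m + 2)
        * (\<Sum>i\<le>m. (cmod (a i (m - i)))\<^sup>2 * (1 / real (Suc i) + 1 / real (Suc (m - i)))))"
    using s by (intro sum_mono mult_left_mono weighted_diagonal_bound) auto
  also have "\<dots> \<le> (\<Sum>m<N. \<Sum>i\<le>m. g i (m - i))"
    unfolding sum_distrib_left
  proof (intro sum_mono)
    fix m i :: nat assume "i \<in> {..m}"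
    then have i: "i \<le> m" by simp
    have "s ^ (m + 1) * (1 / real (Suc i) + 1 / real (Suc (m - i)))
        \<le> s ^ Suc i * (1 / real (Suc i)) + s ^ Suc (m - i) * (1 / real (Suc (m - i)))"
      unfolding distrib_left using s i
      by (intro add_mono mult_right_mono power_decreasing) auto
    then have "((cmod (a i (m - i)))\<^sup>2 * s) * (s ^ (m + 1) * (1 / real (Suc i) + 1 / real (Suc (m - i))))
        \<le> g i (m - i)"
      using s unfolding g_def by (intro mult_left_mono) auto
    then show "s ^ (m + 2) * ((cmod (a i (m - i)))\<^sup>2 * (1 / real (Suc i) + 1 / real (Suc (m - i))))
        \<le> g i (m - i)"
      by (simp add: mult_ac)
  qed
  also have "\<dots> = (\<Sum>(i, k)\<in>{(i, k). i + k < N}. g i k)"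
    by (rule sum.triangle_reindex[symmetric])
  \<comment> \<open>As \<open>g\<close> is nonnegative, the triangle may be enlarged to a square,
    where rows and columns can be summed separately.\<close>
  also have "\<dots> \<le> (\<Sum>(i, k)\<in>{..<N} \<times> {..<N}. g i k)"
    using s by (intro sum_mono2) (auto simp: g_def)
  also have "\<dots> = (\<Sum>i<N. \<Sum>k<N. g i k)"
    by (simp add: sum.cartesian_product)
  also have "\<dots> = s * ((\<Sum>i<N. s ^ Suc i / real (Suc i) * (\<Sum>k<N. (cmod (a i k))\<^sup>2))
      + (\<Sum>i<N. \<Sum>k<N. s ^ Suc k / real (Suc k) * (cmod (a i k))\<^sup>2))"
    by (simp add: g_def sum_distrib_left sum.distrib[symmetric] distrib_left mult_ac)
  also have "(\<Sum>i<N. \<Sum>k<N. s ^ Suc k / real (Suc k) * (cmod (a i k))\<^sup>2)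
      = (\<Sum>k<N. s ^ Suc k / real (Suc k) * (\<Sum>i<N. (cmod (a i k))\<^sup>2))"
    unfolding sum_distrib_left by (rule sum.swap)
  also have "s * ((\<Sum>i<N. s ^ Suc i / real (Suc i) * (\<Sum>k<N. (cmod (a i k))\<^sup>2)) + \<dots>)
      \<le> s * (ln (1 / (1 - s)) + ln (1 / (1 - s)))"
    using s rows cols by (intro mult_left_mono add_mono half) auto
  finally show ?thesis by simp
qed

section \<open>From the coefficient bound to the mean of the product on the circle\<close>

theorem theorem1p7p2:
  fixes M :: "'a measure" and G :: "('a \<Rightarrow> complex) set"
    and \<Phi> \<Psi> :: "'a \<Rightarrow> complex \<Rightarrow> complex" and r :: real
  assumes "jointly_gaussian_D0_GAFs M G \<Phi> \<Psi>"
    and "0 \<le> r" and "r < 1"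
  shows "(\<integral>\<zeta>. (cmod (\<integral>\<omega>. \<Phi> \<omega> (of_real r * \<zeta>) * \<Psi> \<omega> (of_real r * \<zeta>) \<partial>M))\<^sup>2 \<partial>circle_measure)
           \<le> 2 * r\<^sup>2 * ln (1 / (1 - r\<^sup>2)) + r\<^sup>2"
proof -
  interpret gaussian_hilbert_space M G
    using assms(1) by (simp add: jointly_gaussian_D0_GAFs_def)
  have "D0_GAF M G \<Phi>" "D0_GAF M G \<Psi>"
    using assms(1) by (auto simp: jointly_gaussian_D0_GAFs_def)
  then obtain \<alpha> \<beta> where
        \<alpha>: "\<forall>j\<ge>1. \<alpha> j \<in> G \<and> standard_complex_gaussian M (\<alpha> j)"
    and \<alpha>_ind: "indep_vars (\<lambda>_. borel) \<alpha> {1..}"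
    and \<Phi>: "\<forall>\<omega>\<in>space M. \<forall>z\<in>ball 0 1.
        \<Phi> \<omega> z = (\<Sum>j. \<alpha> (Suc j) \<omega> / of_real (sqrt (real (Suc j))) * z ^ Suc j)"
    and \<beta>: "\<forall>j\<ge>1. \<beta> j \<in> G \<and> standard_complex_gaussian M (\<beta> j)"
    and \<beta>_ind: "indep_vars (\<lambda>_. borel) \<beta> {1..}"
    and \<Psi>: "\<forall>\<omega>\<in>space M. \<forall>z\<in>ball 0 1.
        \<Psi> \<omega> z = (\<Sum>j. \<beta> (Suc j) \<omega> / of_real (sqrt (real (Suc j))) * z ^ Suc j)"
    unfolding D0_GAF_def by (elim exE conjE)
  \<comment> \<open>Indices are counted from 0 here: \<open>a i k\<close> belongs to the
    coefficients \<open>i + 1\<close> and \<open>k + 1\<close>, and \<open>d m\<close> is the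
    coefficient of \<open>z ^ (m + 2)\<close>.\<close>
  define a where "a i k = (\<integral>\<omega>. \<alpha> (Suc i) \<omega> * \<beta> (Suc k) \<omega> \<partial>M)" for i k
  define d where
    "d m = (\<Sum>i\<le>m. a i (m - i) / of_real (sqrt (real (Suc i)) * sqrt (real (Suc (m - i)))))" for m
  have L2: "\<alpha> (Suc i) \<in> L2_functions M" "\<beta> (Suc i) \<in> L2_functions M" for i
    using \<alpha> \<beta> subset_L2 by auto
  have norm: "(\<integral>\<omega>. (cmod (\<alpha> (Suc i) \<omega>))\<^sup>2 \<partial>M) = 1" "(\<integral>\<omega>. (cmod (\<beta> (Suc i) \<omega>))\<^sup>2 \<partial>M) = 1" for i
    using \<alpha> \<beta> by (auto simp: standard_complex_gaussian_def)
  have orth: "(\<integral>\<omega>. \<alpha> (Suc i) \<omega> * cnj (\<alpha> (Suc j) \<omega>) \<partial>M) = of_bool (i = j)"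
             "(\<integral>\<omega>. \<beta> (Suc i) \<omega> * cnj (\<beta> (Suc j) \<omega>) \<partial>M) = of_bool (i = j)" for i j
    using indep_standard_gaussians_orthonormal[OF _ \<alpha>_ind, of "Suc i" "Suc j"]
      indep_standard_gaussians_orthonormal[OF _ \<beta>_ind, of "Suc i" "Suc j"] \<alpha> \<beta> by auto
  \<comment> \<open>Bessel for the system of the \<open>\<alpha> (Suc i)\<close> against the unit
    vector \<open>\<beta> (Suc k)\<close>; for \<open>rows\<close> the two systems exchange
    roles.\<close>
  have cols: "(\<Sum>i<N. (cmod (a i k))\<^sup>2) \<le> 1" for k N
    using bessel_inequality[of "{..<N}" "\<lambda>i. \<alpha> (Suc i)", OF _ L2(1) L2(2) orth(1), of k]
    by (simp add: a_def norm)
  have rows: "(\<Sum>k<N. (cmod (a i k))\<^sup>2) \<le> 1" for i N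
    using bessel_inequality[of "{..<N}" "\<lambda>k. \<beta> (Suc k)", OF _ L2(2) L2(1) orth(2), of i]
    by (simp add: a_def norm mult.commute)
  \<comment> \<open>A crude entrywise bound, used below for the absolute summability of the
    coefficients.\<close>
  have a_le: "cmod (a i k) \<le> 1" for i k
    unfolding a_def
    by (rule order_trans[OF integral_norm_bound integral_norm_mult_le_1]) (simp_all add: L2 norm)
  have r2: "0 \<le> r\<^sup>2" "r\<^sup>2 < 1"
    using assms(2,3) by (simp_all add: abs_square_less_1)

  \<comment> \<open>The logarithmic bound comes first; adding the nonnegative
    \<open>r\<^sup>2\<close> at the end gives the claim. Parseval is applied with shift 2 and
    coefficients \<open>d m * of_real (r ^ (m + 2))\<close>.\<close>
  have "(\<integral>\<zeta>. (cmod (\<integral>\<omega>. \<Phi> \<omega> (of_real r * \<zeta>) * \<Psi> \<omega> (of_real r * \<zeta>) \<partial>M))\<^sup>2 \<partial>circle_measure)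
      \<le> 2 * r\<^sup>2 * ln (1 / (1 - r\<^sup>2))"
  proof (rule parseval_le)
    fix \<zeta> :: complex assume \<zeta>: "cmod \<zeta> = 1"
    define z where "z = of_real r * \<zeta>"
    \<comment> \<open>Absorbing both the power of \<open>z\<close> and the weight makes
      \<open>u i * u (m - i)\<close> equal to \<open>z ^ (m + 2)\<close> over the weights in
      \<open>d m\<close>.\<close>
    define u where "u i = z ^ Suc i / of_real (sqrt (real (Suc i)))" for i
    have z: "cmod z = r" "z \<in> ball 0 1"
      using \<zeta> assms(2,3) by (simp_all add: z_def norm_mult)
    have "cmod (u i) \<le> r ^ i" for i
    proof -
      have "cmod (u i) = r ^ Suc i / sqrt (real (Suc i))"
        by (simp add: u_def norm_divide norm_mult norm_power z)
      also have "\<dots> \<le> r ^ Suc i / 1"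
        using assms(2) by (intro divide_left_mono) auto
      also have "\<dots> \<le> r ^ i"
        using assms(2,3) by (simp add: mult_left_le_one_le)
      finally show ?thesis .
    qed
    then have "summable (\<lambda>i. cmod (u i))"
      using assms(2,3) by (intro summable_comparison_test'[OF summable_geometric[of r]]) auto
    then have "(\<lambda>m. \<Sum>i\<le>m. a i (m - i) * (u i * u (m - i)))
        sums (\<integral>\<omega>. (\<Sum>i. \<alpha> (Suc i) \<omega> * u i) * (\<Sum>i. \<beta> (Suc i) \<omega> * u i) \<partial>M)"
      unfolding a_def by (intro expectation_product_series) (simp_all add: L2 norm)
    also have "(\<integral>\<omega>. (\<Sum>i. \<alpha> (Suc i) \<omega> * u i) * (\<Sum>i. \<beta> (Suc i) \<omega> * u i) \<partial>M)
        = (\<integral>\<omega>. \<Phi> \<omega> z * \<Psi> \<omega> z \<partial>M)"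
      using z by (intro Bochner_Integration.integral_cong refl) (simp add: \<Phi> \<Psi> u_def)
    also have "(\<lambda>m. \<Sum>i\<le>m. a i (m - i) * (u i * u (m - i)))
        = (\<lambda>m. d m * of_real (r ^ (m + 2)) * \<zeta> ^ (m + 2))"
    proof
      fix m
      have "u i * u (m - i)
          = z ^ (m + 2) / of_real (sqrt (real (Suc i)) * sqrt (real (Suc (m - i))))" if "i \<le> m" for i
      proof -
        have "m + 2 = Suc i + Suc (m - i)" using that by simp
        then have "z ^ (m + 2) = z ^ Suc i * z ^ Suc (m - i)" by (simp only: power_add)
        then show ?thesis by (simp only: u_def of_real_mult times_divide_times_eq)
      qed
      then have "(\<Sum>i\<le>m. a i (m - i) * (u i * u (m - i))) = d m * z ^ (m + 2)"
        unfolding d_def sum_distrib_right by (intro sum.cong refl) simp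
      then show "(\<Sum>i\<le>m. a i (m - i) * (u i * u (m - i))) = d m * of_real (r ^ (m + 2)) * \<zeta> ^ (m + 2)"
        by (simp add: z_def power_mult_distrib mult_ac)
    qed
    finally show "(\<lambda>m. d m * of_real (r ^ (m + 2)) * \<zeta> ^ (m + 2))
        sums (\<integral>\<omega>. \<Phi> \<omega> (of_real r * \<zeta>) * \<Psi> \<omega> (of_real r * \<zeta>) \<partial>M)"
      by (simp only: z_def)
  next
    \<comment> \<open>\<open>d m\<close> has \<open>m + 1\<close> terms of modulus at most 1, so the
      differentiated geometric series is a majorant.\<close>
    have "summable (\<lambda>m. real (Suc m) * r ^ m)"
      using assms(2,3) by (intro sums_summable[OF geometric_deriv_sums]) auto
    then show "summable (\<lambda>m. cmod (d m * of_real (r ^ (m + 2))))"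
    proof (rule summable_comparison_test')
      fix m :: nat
      have "cmod (d m) \<le> (\<Sum>i\<le>m. 1)"
        unfolding d_def
      proof (rule sum_norm_le)
        fix i
        have "1 * 1 \<le> sqrt (real (Suc i)) * sqrt (real (Suc (m - i)))"
          by (intro mult_mono) auto
        then have "cmod (a i (m - i)) / (sqrt (real (Suc i)) * sqrt (real (Suc (m - i)))) \<le> 1"
          using a_le[of i "m - i"] by (subst divide_le_eq_1) auto
        then show "cmod (a i (m - i) / of_real (sqrt (real (Suc i)) * sqrt (real (Suc (m - i))))) \<le> 1"
          by (simp add: norm_divide norm_mult)
      qed
      then have "cmod (d m) * r ^ (m + 2) \<le> real (Suc m) * r ^ m"
        using assms(2,3) by (intro mult_mono power_decreasing) auto
      then show "norm (cmod (d m * of_real (r ^ (m + 2)))) \<le> real (Suc m) * r ^ m"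
        using assms(2) by (simp add: norm_mult norm_power)
    qed
  next
    fix N
    \<comment> \<open>Squaring turns \<open>r ^ (m + 2)\<close> into \<open>s ^ (m + 2)\<close> with
      \<open>s = r\<^sup>2\<close>, the form of the diagonal estimate.\<close>
    have "(\<Sum>m<N. (cmod (d m * of_real (r ^ (m + 2))))\<^sup>2) = (\<Sum>m<N. (r\<^sup>2) ^ (m + 2) * (cmod (d m))\<^sup>2)"
      by (intro sum.cong refl)
         (simp add: norm_mult norm_power power_mult_distrib power_mult[symmetric] mult_ac assms(2))
    also have "\<dots> \<le> 2 * r\<^sup>2 * ln (1 / (1 - r\<^sup>2))"
      unfolding d_def by (rule diagonal_sum_bound[OF r2 rows cols])
    finally show "(\<Sum>m<N. (cmod (d m * of_real (r ^ (m + 2))))\<^sup>2) \<le> 2 * r\<^sup>2 * ln (1 / (1 - r\<^sup>2))" .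
  qed
  then show ?thesis using r2(1) by linarith
qed

end
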